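(* Let $R$ be any nonzero unital ring. Then the ring $\mathbb{LTDFM}_{\mathbb{N}}(R)$ of lower-triangular diagonal-finite matrices over $R$ is not clean.
   Context: Rings are associative with unity. Let $\mathbb{N} = \{1,2,3,\dots\}$ index rows and columns, and let $\mathbb{CFM}_{\mathbb{N}}(R)$ denote the ring of column-finite matrices $A = (a_{ij})_{i,j=1}^{\infty}$ over $R$ (each column has only finitely many nonzero entries), where $i$ is the row index and $j$ the column index. The ring $\mathbb{LTDFM}_{\mathbb{N}}(R)$ is the subring of $\mathbb{CFM}_{\mathbb{N}}(R)$ consisting of all $A = (a_{ij})$ that are lower triangular ($a_{ij} = 0$ whenever $i < j$) and diagonal-finite (there exists $n \in \mathbb{N}$ such that $a_{ij} = 0$ for all $j \geq 1$ and all $i \geq j + n$). A ring $S$ is clean if for every $a \in S$ there are a unit $u \in S$ and an idempotent $e \in S$ with $a = u + e$. *)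

theory Defs
  imports "HOL-Algebra.Subrings"
begin

(* Rows and columns are indexed from 0: the entry A i j stands for the entry in row i + 1 and
   column j + 1. Every condition below depends only on the relative position of the indices, so
   this relabelling changes nothing. *)
definition column_finite :: "('a, 'm) ring_scheme \<Rightarrow> (nat \<Rightarrow> nat \<Rightarrow> 'a) \<Rightarrow> bool" where
  "column_finite R A \<longleftrightarrow> (\<forall>j. finite {i. A i j \<noteq> \<zero>\<^bsub>R\<^esub>})"

definition lower_triangular :: "('a, 'm) ring_scheme \<Rightarrow> (nat \<Rightarrow> nat \<Rightarrow> 'a) \<Rightarrow> bool" where
  "lower_triangular R A \<longleftrightarrow> (\<forall>i j. i < j \<longrightarrow> A i j = \<zero>\<^bsub>R\<^esub>)"

definition diagonal_finite :: "('a, 'm) ring_scheme \<Rightarrow> (nat \<Rightarrow> nat \<Rightarrow> 'a) \<Rightarrow> bool" where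
  "diagonal_finite R A \<longleftrightarrow> (\<exists>n\<ge>1. \<forall>j i. i \<ge> j + n \<longrightarrow> A i j = \<zero>\<^bsub>R\<^esub>)"

(* In the product, the sum over k runs over the support of column j of B, which is finite
   exactly because B is column-finite. *)
definition CFM :: "('a, 'm) ring_scheme \<Rightarrow> (nat \<Rightarrow> nat \<Rightarrow> 'a) ring" where
  "CFM R =
    \<lparr> carrier = {A. (\<forall>i j. A i j \<in> carrier R) \<and> column_finite R A},
      mult = (\<lambda>A B i j. \<Oplus>\<^bsub>R\<^esub>k\<in>{k. B k j \<noteq> \<zero>\<^bsub>R\<^esub>}. A i k \<otimes>\<^bsub>R\<^esub> B k j),
      one = (\<lambda>i j. if i = j then \<one>\<^bsub>R\<^esub> else \<zero>\<^bsub>R\<^esub>),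
      zero = (\<lambda>i j. \<zero>\<^bsub>R\<^esub>),
      add = (\<lambda>A B i j. A i j \<oplus>\<^bsub>R\<^esub> B i j) \<rparr>"

definition LTDFM :: "('a, 'm) ring_scheme \<Rightarrow> (nat \<Rightarrow> nat \<Rightarrow> 'a) ring" where
  "LTDFM R = (CFM R)
    \<lparr> carrier := {A \<in> carrier (CFM R). lower_triangular R A \<and> diagonal_finite R A} \<rparr>"

definition clean :: "('a, 'm) ring_scheme \<Rightarrow> bool" where
  "clean S \<longleftrightarrow>
    (\<forall>a\<in>carrier S. \<exists>u\<in>Units S. \<exists>e\<in>carrier S. e \<otimes>\<^bsub>S\<^esub> e = e \<and> a = u \<oplus>\<^bsub>S\<^esub> e)"

lemma CFM_simps:
  "A \<in> carrier (CFM R) \<longleftrightarrow> (\<forall>i j. A i j \<in> carrier R) \<and> column_finite R A"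
  "\<one>\<^bsub>CFM R\<^esub> = (\<lambda>i j. if i = j then \<one>\<^bsub>R\<^esub> else \<zero>\<^bsub>R\<^esub>)"
  "\<zero>\<^bsub>CFM R\<^esub> = (\<lambda>i j. \<zero>\<^bsub>R\<^esub>)"
  "A \<oplus>\<^bsub>CFM R\<^esub> B = (\<lambda>i j. A i j \<oplus>\<^bsub>R\<^esub> B i j)"
  by (simp_all add: CFM_def)

lemma column_finite_bound:
  assumes "column_finite R B"
  obtains N where "\<And>k. k \<ge> N \<Longrightarrow> B k j = \<zero>\<^bsub>R\<^esub>"
proof -
  have "finite {k. B k j \<noteq> \<zero>\<^bsub>R\<^esub>}" using assms by (simp add: column_finite_def)
  then obtain N where "\<forall>k\<in>{k. B k j \<noteq> \<zero>\<^bsub>R\<^esub>}. k < N"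
    using finite_nat_set_iff_bounded by blast
  then have "\<And>k. k \<ge> N \<Longrightarrow> B k j = \<zero>\<^bsub>R\<^esub>" by force
  then show thesis by (rule that)
qed

lemma column_finite_bounds:
  assumes "column_finite R B"
  obtains b where "\<And>k i. i \<ge> b k \<Longrightarrow> B i k = \<zero>\<^bsub>R\<^esub>"
proof -
  have "\<forall>k. \<exists>N. \<forall>i\<ge>N. B i k = \<zero>\<^bsub>R\<^esub>" using column_finite_bound[OF assms] by blast
  then obtain b where "\<forall>k. \<forall>i\<ge>b k. B i k = \<zero>\<^bsub>R\<^esub>" by metis
  then show thesis by (intro that) blast
qed

lemma column_finiteI:
  assumes "\<And>j. \<exists>N. \<forall>k\<ge>N. B k j = \<zero>\<^bsub>R\<^esub>"
  shows "column_finite R B"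
  unfolding column_finite_def
proof
  fix j
  obtain N where "\<forall>k\<ge>N. B k j = \<zero>\<^bsub>R\<^esub>" using assms by blast
  then have "{i. B i j \<noteq> \<zero>\<^bsub>R\<^esub>} \<subseteq> {..<N}" by (force simp: not_le[symmetric])
  then show "finite {i. B i j \<noteq> \<zero>\<^bsub>R\<^esub>}" using finite_subset by blast
qed

context ring
begin

lemma finsum_swap:
  assumes "finite X" "finite Y" "\<And>x y. f x y \<in> carrier R"
  shows "(\<Oplus>x\<in>X. \<Oplus>y\<in>Y. f x y) = (\<Oplus>y\<in>Y. \<Oplus>x\<in>X. f x y)"
  using assms(1)
proof induction
  case empty
  then show ?case by simp
next
  case (insert a X)
  have "(\<Oplus>y\<in>Y. \<Oplus>x\<in>insert a X. f x y) = (\<Oplus>y\<in>Y. f a y \<oplus> (\<Oplus>x\<in>X. f x y))"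
    using insert assms by (intro finsum_cong') (auto intro!: finsum_closed)
  also have "\<dots> = (\<Oplus>y\<in>Y. f a y) \<oplus> (\<Oplus>y\<in>Y. \<Oplus>x\<in>X. f x y)"
    using assms by (intro finsum_addf) (auto intro!: finsum_closed)
  finally show ?case using insert assms by (auto intro!: finsum_closed)
qed

lemma CFM_mult_bound:
  assumes "\<And>i j. A i j \<in> carrier R" "\<And>i j. B i j \<in> carrier R"
    and "\<And>k. k \<ge> N \<Longrightarrow> B k j = \<zero>"
  shows "(A \<otimes>\<^bsub>CFM R\<^esub> B) i j = (\<Oplus>k\<in>{..<N}. A i k \<otimes> B k j)"
proof -
  have "(\<Oplus>k\<in>{k. B k j \<noteq> \<zero>}. A i k \<otimes> B k j) = (\<Oplus>k\<in>{..<N}. A i k \<otimes> B k j)"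
    using assms
    by (intro add.finprod_mono_neutral_cong_left) (auto simp: not_le[symmetric])
  then show ?thesis by (simp add: CFM_def)
qed

lemma CFM_mult_closed:
  assumes A: "A \<in> carrier (CFM R)" and B: "B \<in> carrier (CFM R)"
  shows "A \<otimes>\<^bsub>CFM R\<^esub> B \<in> carrier (CFM R)"
proof -
  have cA: "\<And>i j. A i j \<in> carrier R" and cB: "\<And>i j. B i j \<in> carrier R"
    and fA: "column_finite R A" and fB: "column_finite R B"
    using A B by (auto simp: CFM_simps)
  have "\<exists>M. \<forall>i\<ge>M. (A \<otimes>\<^bsub>CFM R\<^esub> B) i j = \<zero>" for j
  proof -
    obtain N where N: "\<And>k. k \<ge> N \<Longrightarrow> B k j = \<zero>" using column_finite_bound[OF fB] by blast
    obtain b where b: "\<And>k i. i \<ge> b k \<Longrightarrow> A i k = \<zero>" using column_finite_bounds[OF fA] by blast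
    have "(A \<otimes>\<^bsub>CFM R\<^esub> B) i j = \<zero>" if i: "i \<ge> (\<Sum>k<N. b k)" for i
    proof -
      have "A i k = \<zero>" if "k < N" for k
        using that i member_le_sum[of k "{..<N}" b] by (intro b) simp
      then have "(\<Oplus>k\<in>{..<N}. A i k \<otimes> B k j) = \<zero>"
        using cB by (intro add.finprod_one_eqI) simp
      then show ?thesis using CFM_mult_bound[of A B N j i, OF cA cB N] by simp
    qed
    then show ?thesis by blast
  qed
  then have "column_finite R (A \<otimes>\<^bsub>CFM R\<^esub> B)" by (intro column_finiteI) blast
  moreover have "(A \<otimes>\<^bsub>CFM R\<^esub> B) i j \<in> carrier R" for i j
    using cA cB by (auto simp: CFM_def intro!: finsum_closed)
  ultimately show ?thesis by (simp add: CFM_simps)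
qed

lemma CFM_mult_assoc:
  assumes A: "A \<in> carrier (CFM R)" and B: "B \<in> carrier (CFM R)" and C: "C \<in> carrier (CFM R)"
  shows "(A \<otimes>\<^bsub>CFM R\<^esub> B) \<otimes>\<^bsub>CFM R\<^esub> C = A \<otimes>\<^bsub>CFM R\<^esub> (B \<otimes>\<^bsub>CFM R\<^esub> C)"
proof (intro ext)
  fix i j
  have c: "\<And>i j. A i j \<in> carrier R" "\<And>i j. B i j \<in> carrier R" "\<And>i j. C i j \<in> carrier R"
    and fB: "column_finite R B" and fC: "column_finite R C"
    using A B C by (auto simp: CFM_simps)
  have cAB: "\<And>i j. (A \<otimes>\<^bsub>CFM R\<^esub> B) i j \<in> carrier R" "\<And>i j. (B \<otimes>\<^bsub>CFM R\<^esub> C) i j \<in> carrier R"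
    and fBC: "column_finite R (B \<otimes>\<^bsub>CFM R\<^esub> C)"
    using CFM_mult_closed[OF A B] CFM_mult_closed[OF B C] by (auto simp: CFM_simps)
  obtain N where N: "\<And>k. k \<ge> N \<Longrightarrow> C k j = \<zero>" using column_finite_bound[OF fC] by blast
  obtain b where b: "\<And>k i. i \<ge> b k \<Longrightarrow> B i k = \<zero>" using column_finite_bounds[OF fB] by blast
  obtain M0 where M0: "\<And>k. k \<ge> M0 \<Longrightarrow> (B \<otimes>\<^bsub>CFM R\<^esub> C) k j = \<zero>"
    using column_finite_bound[OF fBC] by blast
  define M where "M = M0 + (\<Sum>k<N. b k)"
  have MB: "B l k = \<zero>" if "k < N" "l \<ge> M" for k l
    using that member_le_sum[of k "{..<N}" b] by (intro b) (simp add: M_def)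
  have "((A \<otimes>\<^bsub>CFM R\<^esub> B) \<otimes>\<^bsub>CFM R\<^esub> C) i j = (\<Oplus>k\<in>{..<N}. (A \<otimes>\<^bsub>CFM R\<^esub> B) i k \<otimes> C k j)"
    by (rule CFM_mult_bound[of "A \<otimes>\<^bsub>CFM R\<^esub> B" C, OF cAB(1) c(3) N])
  also have "\<dots> = (\<Oplus>k\<in>{..<N}. \<Oplus>l\<in>{..<M}. A i l \<otimes> B l k \<otimes> C k j)"
  proof (intro finsum_cong' refl)
    fix k assume "k \<in> {..<N}"
    then have "(A \<otimes>\<^bsub>CFM R\<^esub> B) i k = (\<Oplus>l\<in>{..<M}. A i l \<otimes> B l k)"
      using MB by (intro CFM_mult_bound c) auto
    then show "(A \<otimes>\<^bsub>CFM R\<^esub> B) i k \<otimes> C k j = (\<Oplus>l\<in>{..<M}. A i l \<otimes> B l k \<otimes> C k j)"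
      using c by (simp add: finsum_ldistr)
  qed (use c in \<open>auto intro!: finsum_closed\<close>)
  also have "\<dots> = (\<Oplus>l\<in>{..<M}. \<Oplus>k\<in>{..<N}. A i l \<otimes> B l k \<otimes> C k j)"
    using c by (intro finsum_swap) auto
  also have "\<dots> = (\<Oplus>l\<in>{..<M}. A i l \<otimes> (B \<otimes>\<^bsub>CFM R\<^esub> C) l j)"
  proof (intro finsum_cong' refl)
    fix l
    have "(B \<otimes>\<^bsub>CFM R\<^esub> C) l j = (\<Oplus>k\<in>{..<N}. B l k \<otimes> C k j)"
      by (rule CFM_mult_bound[of B C, OF c(2) c(3) N])
    then show "(\<Oplus>k\<in>{..<N}. A i l \<otimes> B l k \<otimes> C k j) = A i l \<otimes> (B \<otimes>\<^bsub>CFM R\<^esub> C) l j"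
      using c by (simp add: finsum_rdistr m_assoc)
  qed (use c cAB in auto)
  also have "\<dots> = (A \<otimes>\<^bsub>CFM R\<^esub> (B \<otimes>\<^bsub>CFM R\<^esub> C)) i j"
    using M0 by (intro CFM_mult_bound[of A "B \<otimes>\<^bsub>CFM R\<^esub> C", OF c(1) cAB(2), symmetric]) (simp add: M_def)
  finally show "((A \<otimes>\<^bsub>CFM R\<^esub> B) \<otimes>\<^bsub>CFM R\<^esub> C) i j = (A \<otimes>\<^bsub>CFM R\<^esub> (B \<otimes>\<^bsub>CFM R\<^esub> C)) i j" .
qed

lemma CFM_one_mult:
  assumes A: "A \<in> carrier (CFM R)"
  shows "\<one>\<^bsub>CFM R\<^esub> \<otimes>\<^bsub>CFM R\<^esub> A = A" "A \<otimes>\<^bsub>CFM R\<^esub> \<one>\<^bsub>CFM R\<^esub> = A"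
proof -
  have c: "\<And>i j. A i j \<in> carrier R" "\<And>i j. \<one>\<^bsub>CFM R\<^esub> i j \<in> carrier R" and f: "column_finite R A"
    using A by (auto simp: CFM_simps)
  show "\<one>\<^bsub>CFM R\<^esub> \<otimes>\<^bsub>CFM R\<^esub> A = A"
  proof (intro ext)
    fix i j
    obtain N0 where "\<And>k. k \<ge> N0 \<Longrightarrow> A k j = \<zero>" using column_finite_bound[OF f] by blast
    then have N: "\<And>k. k \<ge> N0 + Suc i \<Longrightarrow> A k j = \<zero>" by simp
    have "(\<one>\<^bsub>CFM R\<^esub> \<otimes>\<^bsub>CFM R\<^esub> A) i j = (\<Oplus>k\<in>{..<N0 + Suc i}. \<one>\<^bsub>CFM R\<^esub> i k \<otimes> A k j)"
      by (rule CFM_mult_bound[of "\<one>\<^bsub>CFM R\<^esub>" A, OF c(2) c(1) N])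
    also have "\<dots> = (\<Oplus>k\<in>{..<N0 + Suc i}. if i = k then A k j else \<zero>)"
      using c by (intro finsum_cong') (auto simp: CFM_simps)
    also have "\<dots> = A i j"
      using c by (intro finsum_singleton) auto
    finally show "(\<one>\<^bsub>CFM R\<^esub> \<otimes>\<^bsub>CFM R\<^esub> A) i j = A i j" .
  qed
  show "A \<otimes>\<^bsub>CFM R\<^esub> \<one>\<^bsub>CFM R\<^esub> = A"
  proof (intro ext)
    fix i j
    have "(A \<otimes>\<^bsub>CFM R\<^esub> \<one>\<^bsub>CFM R\<^esub>) i j = (\<Oplus>k\<in>{..<Suc j}. A i k \<otimes> \<one>\<^bsub>CFM R\<^esub> k j)"
      by (rule CFM_mult_bound[of A "\<one>\<^bsub>CFM R\<^esub>", OF c]) (simp add: CFM_simps)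
    also have "\<dots> = (\<Oplus>k\<in>{..<Suc j}. if j = k then A i k else \<zero>)"
      using c by (intro finsum_cong') (auto simp: CFM_simps)
    also have "\<dots> = A i j"
      using c by (intro finsum_singleton) auto
    finally show "(A \<otimes>\<^bsub>CFM R\<^esub> \<one>\<^bsub>CFM R\<^esub>) i j = A i j" .
  qed
qed

lemma CFM_add_closed:
  assumes "A \<in> carrier (CFM R)" "B \<in> carrier (CFM R)"
  shows "A \<oplus>\<^bsub>CFM R\<^esub> B \<in> carrier (CFM R)"
proof -
  have "column_finite R (A \<oplus>\<^bsub>CFM R\<^esub> B)"
    unfolding column_finite_def
  proof
    fix j
    have "{i. (A \<oplus>\<^bsub>CFM R\<^esub> B) i j \<noteq> \<zero>} \<subseteq> {i. A i j \<noteq> \<zero>} \<union> {i. B i j \<noteq> \<zero>}"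
      by (auto simp: CFM_simps)
    moreover have "finite ({i. A i j \<noteq> \<zero>} \<union> {i. B i j \<noteq> \<zero>})"
      using assms by (simp add: CFM_simps column_finite_def)
    ultimately show "finite {i. (A \<oplus>\<^bsub>CFM R\<^esub> B) i j \<noteq> \<zero>}" by (rule finite_subset)
  qed
  then show ?thesis using assms by (simp add: CFM_simps)
qed

lemma CFM_uminus_closed:
  assumes "A \<in> carrier (CFM R)"
  shows "(\<lambda>i j. \<ominus> A i j) \<in> carrier (CFM R)"
proof -
  have "{i. \<ominus> A i j \<noteq> \<zero>} \<subseteq> {i. A i j \<noteq> \<zero>}" for j by auto
  then have "column_finite R (\<lambda>i j. \<ominus> A i j)"
    using assms unfolding CFM_simps column_finite_def by (meson finite_subset)
  then show ?thesis using assms by (simp add: CFM_simps)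
qed

lemma CFM_abelian_group: "abelian_group (CFM R)"
proof (rule abelian_groupI)
  show "\<zero>\<^bsub>CFM R\<^esub> \<in> carrier (CFM R)" by (simp add: CFM_simps column_finite_def)
next
  fix A assume "A \<in> carrier (CFM R)"
  then show "\<exists>B\<in>carrier (CFM R). B \<oplus>\<^bsub>CFM R\<^esub> A = \<zero>\<^bsub>CFM R\<^esub>"
    by (intro bexI[of _ "\<lambda>i j. \<ominus> A i j"] CFM_uminus_closed) (auto simp: CFM_simps l_neg)
qed (auto simp: CFM_add_closed, auto simp: CFM_simps a_ac)

lemma CFM_distr:
  assumes A: "A \<in> carrier (CFM R)" and B: "B \<in> carrier (CFM R)" and C: "C \<in> carrier (CFM R)"
  shows "(A \<oplus>\<^bsub>CFM R\<^esub> B) \<otimes>\<^bsub>CFM R\<^esub> C = A \<otimes>\<^bsub>CFM R\<^esub> C \<oplus>\<^bsub>CFM R\<^esub> B \<otimes>\<^bsub>CFM R\<^esub> C"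
    and "C \<otimes>\<^bsub>CFM R\<^esub> (A \<oplus>\<^bsub>CFM R\<^esub> B) = C \<otimes>\<^bsub>CFM R\<^esub> A \<oplus>\<^bsub>CFM R\<^esub> C \<otimes>\<^bsub>CFM R\<^esub> B"
proof -
  have c: "\<And>i j. A i j \<in> carrier R" "\<And>i j. B i j \<in> carrier R" "\<And>i j. C i j \<in> carrier R"
    and f: "column_finite R A" "column_finite R B" "column_finite R C"
    using A B C by (auto simp: CFM_simps)
  have cAB: "\<And>i j. (A \<oplus>\<^bsub>CFM R\<^esub> B) i j \<in> carrier R" using c by (simp add: CFM_simps)
  show "(A \<oplus>\<^bsub>CFM R\<^esub> B) \<otimes>\<^bsub>CFM R\<^esub> C = A \<otimes>\<^bsub>CFM R\<^esub> C \<oplus>\<^bsub>CFM R\<^esub> B \<otimes>\<^bsub>CFM R\<^esub> C"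
  proof (intro ext)
    fix i j
    obtain N where N: "\<And>k. k \<ge> N \<Longrightarrow> C k j = \<zero>" using column_finite_bound[OF f(3)] by blast
    have "((A \<oplus>\<^bsub>CFM R\<^esub> B) \<otimes>\<^bsub>CFM R\<^esub> C) i j = (\<Oplus>k\<in>{..<N}. (A i k \<oplus> B i k) \<otimes> C k j)"
      using CFM_mult_bound[of "A \<oplus>\<^bsub>CFM R\<^esub> B" C N j i, OF cAB c(3) N] by (simp add: CFM_simps(4))
    also have "\<dots> = (\<Oplus>k\<in>{..<N}. A i k \<otimes> C k j \<oplus> B i k \<otimes> C k j)"
      using c by (intro finsum_cong') (auto simp: l_distr)
    also have "\<dots> = (A \<otimes>\<^bsub>CFM R\<^esub> C) i j \<oplus> (B \<otimes>\<^bsub>CFM R\<^esub> C) i j"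
      using CFM_mult_bound[of A C N j i, OF c(1) c(3) N] CFM_mult_bound[of B C N j i, OF c(2) c(3) N] c
      by (simp add: finsum_addf)
    finally show "((A \<oplus>\<^bsub>CFM R\<^esub> B) \<otimes>\<^bsub>CFM R\<^esub> C) i j = (A \<otimes>\<^bsub>CFM R\<^esub> C \<oplus>\<^bsub>CFM R\<^esub> B \<otimes>\<^bsub>CFM R\<^esub> C) i j"
      by (simp add: CFM_simps(4))
  qed
  show "C \<otimes>\<^bsub>CFM R\<^esub> (A \<oplus>\<^bsub>CFM R\<^esub> B) = C \<otimes>\<^bsub>CFM R\<^esub> A \<oplus>\<^bsub>CFM R\<^esub> C \<otimes>\<^bsub>CFM R\<^esub> B"
  proof (intro ext)
    fix i j
    obtain N1 where "\<And>k. k \<ge> N1 \<Longrightarrow> A k j = \<zero>" using column_finite_bound[OF f(1)] by blast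
    moreover obtain N2 where "\<And>k. k \<ge> N2 \<Longrightarrow> B k j = \<zero>" using column_finite_bound[OF f(2)] by blast
    ultimately obtain N where N: "\<And>k. k \<ge> N \<Longrightarrow> A k j = \<zero>" "\<And>k. k \<ge> N \<Longrightarrow> B k j = \<zero>"
      by (meson add_leE)
    have NAB: "\<And>k. k \<ge> N \<Longrightarrow> (A \<oplus>\<^bsub>CFM R\<^esub> B) k j = \<zero>" using N by (simp add: CFM_simps)
    have "(C \<otimes>\<^bsub>CFM R\<^esub> (A \<oplus>\<^bsub>CFM R\<^esub> B)) i j = (\<Oplus>k\<in>{..<N}. C i k \<otimes> (A k j \<oplus> B k j))"
      using CFM_mult_bound[of C "A \<oplus>\<^bsub>CFM R\<^esub> B" N j i, OF c(3) cAB NAB] by (simp add: CFM_simps(4))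
    also have "\<dots> = (\<Oplus>k\<in>{..<N}. C i k \<otimes> A k j \<oplus> C i k \<otimes> B k j)"
      using c by (intro finsum_cong') (auto simp: r_distr)
    also have "\<dots> = (C \<otimes>\<^bsub>CFM R\<^esub> A) i j \<oplus> (C \<otimes>\<^bsub>CFM R\<^esub> B) i j"
      using CFM_mult_bound[of C A N j i, OF c(3) c(1) N(1)]
        CFM_mult_bound[of C B N j i, OF c(3) c(2) N(2)] c
      by (simp add: finsum_addf)
    finally show "(C \<otimes>\<^bsub>CFM R\<^esub> (A \<oplus>\<^bsub>CFM R\<^esub> B)) i j = (C \<otimes>\<^bsub>CFM R\<^esub> A \<oplus>\<^bsub>CFM R\<^esub> C \<otimes>\<^bsub>CFM R\<^esub> B) i j"
      by (simp add: CFM_simps(4))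
  qed
qed

lemma CFM_ring: "ring (CFM R)"
proof (rule ringI)
  show "monoid (CFM R)"
  proof (rule monoidI)
    show "\<one>\<^bsub>CFM R\<^esub> \<in> carrier (CFM R)" by (auto simp: CFM_simps column_finite_def)
  qed (simp_all add: CFM_mult_closed CFM_mult_assoc CFM_one_mult)
qed (simp_all add: CFM_abelian_group CFM_distr)

lemma LTDFM_subring: "subring (carrier (LTDFM R)) (CFM R)"
proof (rule ring.subringI[OF CFM_ring])
  show "carrier (LTDFM R) \<subseteq> carrier (CFM R)" by (auto simp: LTDFM_def)
  show "\<one>\<^bsub>CFM R\<^esub> \<in> carrier (LTDFM R)"
    using CFM_ring[THEN ring.ring_simprules(6)]
    by (auto simp: LTDFM_def lower_triangular_def diagonal_finite_def CFM_simps(2))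
next
  fix A assume A: "A \<in> carrier (LTDFM R)"
  then have cA: "A \<in> carrier (CFM R)" by (simp add: LTDFM_def)
  have "(\<lambda>i j. \<ominus> A i j) \<oplus>\<^bsub>CFM R\<^esub> A = \<zero>\<^bsub>CFM R\<^esub>" using cA by (auto simp: CFM_simps l_neg)
  then have "\<ominus>\<^bsub>CFM R\<^esub> A = (\<lambda>i j. \<ominus> A i j)"
    using abelian_group.minus_equality[OF CFM_abelian_group _ cA CFM_uminus_closed[OF cA]] by blast
  moreover have "(\<lambda>i j. \<ominus> A i j) \<in> carrier (LTDFM R)"
  proof -
    have lt: "lower_triangular R A" and "diagonal_finite R A" using A by (simp_all add: LTDFM_def)
    then obtain n where "n \<ge> 1" "\<And>i j. i \<ge> j + n \<Longrightarrow> A i j = \<zero>"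
      unfolding diagonal_finite_def by blast
    then have "diagonal_finite R (\<lambda>i j. \<ominus> A i j)"
      unfolding diagonal_finite_def by (intro exI[of _ n]) simp
    moreover have "lower_triangular R (\<lambda>i j. \<ominus> A i j)"
      using lt by (simp add: lower_triangular_def)
    ultimately show ?thesis using CFM_uminus_closed[OF cA] by (simp add: LTDFM_def)
  qed
  ultimately show "\<ominus>\<^bsub>CFM R\<^esub> A \<in> carrier (LTDFM R)" by simp
next
  fix A B assume AB: "A \<in> carrier (LTDFM R)" "B \<in> carrier (LTDFM R)"
  then have cAB: "A \<in> carrier (CFM R)" "B \<in> carrier (CFM R)"
    and lt: "lower_triangular R A" "lower_triangular R B" by (simp_all add: LTDFM_def)
  then have c: "\<And>i j. A i j \<in> carrier R" "\<And>i j. B i j \<in> carrier R" by (auto simp: CFM_simps)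
  obtain m n where mn: "m \<ge> 1" "n \<ge> 1"
    and m: "\<And>i j. i \<ge> j + m \<Longrightarrow> A i j = \<zero>" and n: "\<And>i j. i \<ge> j + n \<Longrightarrow> B i j = \<zero>"
    using AB unfolding LTDFM_def diagonal_finite_def by auto
  have "diagonal_finite R (A \<oplus>\<^bsub>CFM R\<^esub> B)"
    unfolding diagonal_finite_def using m n mn by (intro exI[of _ "m + n"]) (simp add: CFM_simps(4))
  moreover have "lower_triangular R (A \<oplus>\<^bsub>CFM R\<^esub> B)"
    using lt by (simp add: lower_triangular_def CFM_simps(4))
  ultimately show "A \<oplus>\<^bsub>CFM R\<^esub> B \<in> carrier (LTDFM R)"
    using CFM_add_closed[OF cAB] by (simp add: LTDFM_def)
  have term0: "A i k \<otimes> B k j = \<zero>" if "i < j \<or> i \<ge> j + (m + n)" for i j k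
  proof -
    have "A i k = \<zero> \<or> B k j = \<zero>"
    proof (cases "i < j")
      case True
      then show ?thesis using lt unfolding lower_triangular_def by (metis less_trans linorder_neqE_nat)
    next
      case False
      then have "i \<ge> k + m \<or> k \<ge> j + n" using that by linarith
      then show ?thesis using m n by blast
    qed
    then show ?thesis using c by auto
  qed
  have "(A \<otimes>\<^bsub>CFM R\<^esub> B) i j = \<zero>" if "i < j \<or> i \<ge> j + (m + n)" for i j
    using term0[OF that] by (auto simp: CFM_def intro!: add.finprod_one_eqI)
  then have "lower_triangular R (A \<otimes>\<^bsub>CFM R\<^esub> B)" "diagonal_finite R (A \<otimes>\<^bsub>CFM R\<^esub> B)"
    unfolding lower_triangular_def diagonal_finite_def using mn
    by (blast, intro exI[of _ "m + n"]) simp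
  then show "A \<otimes>\<^bsub>CFM R\<^esub> B \<in> carrier (LTDFM R)"
    using CFM_mult_closed[OF cAB] by (simp add: LTDFM_def)
qed

lemma LTDFM_ring: "ring (LTDFM R)"
  using ring.subring_is_ring[OF CFM_ring LTDFM_subring] by (simp add: LTDFM_def)

end

end

theory Submission
  imports Defs
begin

text \<open>
  The lower shift \<open>S\<close>, with \<open>S e\<^sub>j = e\<^sub>j\<^sub>+\<^sub>1\<close>, is not the sum of a unit and an idempotent.
  Suppose \<open>S = U + E\<close>. Taking a diagonal entry is multiplicative on lower triangular matrices,
  so the diagonal entries of \<open>U\<close> are units of \<open>R\<close> and those of \<open>E\<close> are idempotents
  (\<open>LTDFM_mult_diagonal\<close>). The diagonal of \<open>S\<close> is zero, so each \<open>E\<^sub>i\<^sub>i = - U\<^sub>i\<^sub>i\<close> is an idempotent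
  unit, hence \<open>1\<close> (\<open>idempotent_unit_eq_one\<close>). An idempotent lower triangular matrix with unit
  diagonal is the identity (\<open>LTDFM_unipotent_idempotent\<close>), which leaves \<open>U = S - 1\<close>.
  But the only possible right inverse of \<open>S - 1\<close> among lower triangular matrices is the geometric
  series \<open>- (1 + S + S\<^sup>2 + \<dots>)\<close>, whose columns have infinitely many nonzero entries as soon as
  \<open>1 \<noteq> 0\<close> in \<open>R\<close>.
\<close>

definition lower_shift :: "('a, 'm) ring_scheme \<Rightarrow> nat \<Rightarrow> nat \<Rightarrow> 'a" where
  "lower_shift R i j = (if i = Suc j then \<one>\<^bsub>R\<^esub> else \<zero>\<^bsub>R\<^esub>)"

lemma (in monoid) idempotent_unit_eq_one:
  assumes "e \<in> Units G" "e \<otimes> e = e"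
  shows "e = \<one>"
  using assms by (metis Units_closed Units_l_cancel one_closed r_one)

context ring
begin

lemma finsum_supported_on_pair:
  assumes "finite X" "p \<in> X" "q \<in> X" "p \<noteq> q"
    and "f p \<in> carrier R" "f q \<in> carrier R"
    and "\<And>k. k \<in> X \<Longrightarrow> k \<noteq> p \<Longrightarrow> k \<noteq> q \<Longrightarrow> f k = \<zero>"
  shows "(\<Oplus>k\<in>X. f k) = f p \<oplus> f q"
proof -
  have "(\<Oplus>k\<in>X. f k) = (\<Oplus>k\<in>{p, q}. f k)"
  proof (rule add.finprod_mono_neutral_cong_right)
    show "f \<in> X \<rightarrow> carrier R" using assms by (metis Pi_I zero_closed)
  qed (use assms in auto)
  then show ?thesis using assms by simp
qed

lemma LTDFM_entry_closed: "A \<in> carrier (LTDFM R) \<Longrightarrow> A i j \<in> carrier R"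
  by (simp add: LTDFM_def CFM_simps)

lemma LTDFM_above_diagonal: "A \<in> carrier (LTDFM R) \<Longrightarrow> i < j \<Longrightarrow> A i j = \<zero>"
  by (simp add: LTDFM_def lower_triangular_def)

lemma LTDFM_ops:
  "A \<oplus>\<^bsub>LTDFM R\<^esub> B = (\<lambda>i j. A i j \<oplus> B i j)"
  "\<one>\<^bsub>LTDFM R\<^esub> = (\<lambda>i j. if i = j then \<one> else \<zero>)"
  by (simp_all add: LTDFM_def CFM_simps)

text \<open>
  Triangularity kills every term of the product outside \<open>j \<le> k \<le> i\<close>, so that a sum over the
  support of a column turns into one over a fixed finite interval.
\<close>
lemma LTDFM_mult_entry:
  assumes A: "A \<in> carrier (LTDFM R)" and B: "B \<in> carrier (LTDFM R)"
  shows "(A \<otimes>\<^bsub>LTDFM R\<^esub> B) i j = (\<Oplus>k\<in>{j..i}. A i k \<otimes> B k j)"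
proof -
  note closed = LTDFM_entry_closed[OF A] LTDFM_entry_closed[OF B]
  have "column_finite R B" using B by (simp add: LTDFM_def CFM_simps)
  then obtain N0 where N0: "\<And>k. k \<ge> N0 \<Longrightarrow> B k j = \<zero>" using column_finite_bound by blast
  define N where "N = N0 + Suc i"
  have "(A \<otimes>\<^bsub>LTDFM R\<^esub> B) i j = (\<Oplus>k\<in>{..<N}. A i k \<otimes> B k j)"
    using CFM_mult_bound[of A B N j i] closed N0 by (simp add: LTDFM_def N_def)
  also have "\<dots> = (\<Oplus>k\<in>{j..i}. A i k \<otimes> B k j)"
  proof (rule add.finprod_mono_neutral_cong_right)
    show "{j..i} \<subseteq> {..<N}" by (auto simp: N_def)
    fix k assume "k \<in> {..<N} - {j..i}"
    then have "k < j \<or> i < k" by auto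
    then show "A i k \<otimes> B k j = \<zero>"
      using LTDFM_above_diagonal[OF A] LTDFM_above_diagonal[OF B] closed by auto
  qed (use closed in auto)
  finally show ?thesis .
qed

lemma LTDFM_mult_diagonal:
  assumes "A \<in> carrier (LTDFM R)" "B \<in> carrier (LTDFM R)"
  shows "(A \<otimes>\<^bsub>LTDFM R\<^esub> B) i i = A i i \<otimes> B i i"
  using assms by (simp add: LTDFM_mult_entry LTDFM_entry_closed)

lemma LTDFM_Units_diagonal:
  assumes "U \<in> Units (LTDFM R)"
  shows "U i i \<in> Units R"
proof -
  obtain V where U: "U \<in> carrier (LTDFM R)" and V: "V \<in> carrier (LTDFM R)"
    and inv: "U \<otimes>\<^bsub>LTDFM R\<^esub> V = \<one>\<^bsub>LTDFM R\<^esub>" "V \<otimes>\<^bsub>LTDFM R\<^esub> U = \<one>\<^bsub>LTDFM R\<^esub>"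
    using assms by (auto simp: Units_def)
  have "U i i \<otimes> V i i = \<one>" "V i i \<otimes> U i i = \<one>"
    using LTDFM_mult_diagonal[OF U V, of i] LTDFM_mult_diagonal[OF V U, of i] inv
    by (simp_all add: LTDFM_ops)
  then show ?thesis
    using LTDFM_entry_closed[OF U] LTDFM_entry_closed[OF V] by (auto simp: Units_def)
qed

text \<open>
  Go down one subdiagonal at a time. If \<open>E\<close> agrees with the identity on the diagonals closer to
  the main one, then only \<open>k = i\<close> and \<open>k = j\<close> contribute to \<open>(E E)\<^sub>i\<^sub>j\<close>, and \<open>E E = E\<close> reads
  \<open>E\<^sub>i\<^sub>j + E\<^sub>i\<^sub>j = E\<^sub>i\<^sub>j\<close>.
\<close>
lemma LTDFM_unipotent_idempotent:
  assumes E: "E \<in> carrier (LTDFM R)" and idem: "E \<otimes>\<^bsub>LTDFM R\<^esub> E = E"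
    and diag: "\<And>i. E i i = \<one>"
  shows "E = \<one>\<^bsub>LTDFM R\<^esub>"
proof -
  note closed = LTDFM_entry_closed[OF E]
  have below: "E i j = \<zero>" if "j < i" for i j
    using that
  proof (induction "i - j" arbitrary: i j rule: less_induct)
    case less
    have "E i j = (\<Oplus>k\<in>{j..i}. E i k \<otimes> E k j)"
      using LTDFM_mult_entry[OF E E, of i j] idem by simp
    also have "\<dots> = E i i \<otimes> E i j \<oplus> E i j \<otimes> E j j"
    proof (rule finsum_supported_on_pair)
      fix k assume "k \<in> {j..i}" "k \<noteq> i" "k \<noteq> j"
      then have "E i k = \<zero>" by (intro less.hyps) auto
      then show "E i k \<otimes> E k j = \<zero>" using closed by simp
    qed (use less.prems closed in auto)
    finally have "E i j \<oplus> E i j = E i j" using closed diag by simp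
    then show ?case using closed add.r_cancel_one' by metis
  qed
  show ?thesis
  proof (intro ext)
    fix i j
    show "E i j = \<one>\<^bsub>LTDFM R\<^esub> i j"
      using below[of j i] LTDFM_above_diagonal[OF E, of i j] diag
      by (cases i j rule: linorder_cases) (auto simp: LTDFM_ops)
  qed
qed

lemma lower_shift_closed: "lower_shift R \<in> carrier (LTDFM R)"
proof -
  have "column_finite R (lower_shift R)"
  proof (rule column_finiteI)
    show "\<exists>N. \<forall>k\<ge>N. lower_shift R k j = \<zero>" for j
      by (intro exI[of _ "Suc (Suc j)"]) (auto simp: lower_shift_def)
  qed
  moreover have "diagonal_finite R (lower_shift R)"
    unfolding diagonal_finite_def by (intro exI[of _ 2]) (auto simp: lower_shift_def)
  ultimately show ?thesis
    by (auto simp: LTDFM_def CFM_simps lower_triangular_def lower_shift_def)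
qed

text \<open>
  In column \<open>0\<close>, the equation \<open>U V = 1\<close> for \<open>U = S - 1\<close> is the recursion \<open>V\<^sub>m\<^sub>0 - V\<^sub>m\<^sub>+\<^sub>1\<^sub>,\<^sub>0 = 0\<close>
  with \<open>V\<^sub>0\<^sub>0 = - 1\<close>; a column that is eventually zero would be zero throughout.
\<close>
lemma lower_shift_minus_one_not_unit:
  assumes nontrivial: "\<one> \<noteq> \<zero>"
    and split: "lower_shift R = U \<oplus>\<^bsub>LTDFM R\<^esub> \<one>\<^bsub>LTDFM R\<^esub>"
  shows "U \<notin> Units (LTDFM R)"
proof
  assume "U \<in> Units (LTDFM R)"
  then obtain V where U: "U \<in> carrier (LTDFM R)" and V: "V \<in> carrier (LTDFM R)"
    and inv: "U \<otimes>\<^bsub>LTDFM R\<^esub> V = \<one>\<^bsub>LTDFM R\<^esub>"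
    by (auto simp: Units_def)
  note closed = LTDFM_entry_closed[OF U] LTDFM_entry_closed[OF V]
  have entry: "U i j \<oplus> (if i = j then \<one> else \<zero>) = lower_shift R i j" for i j
    using fun_cong[OF fun_cong[OF split], of i j] by (simp add: LTDFM_ops)
  have U_diag: "U i i = \<ominus> \<one>" for i
    using entry[of i i] closed by (simp add: lower_shift_def minus_equality)
  have U_off: "U i j = lower_shift R i j" if "i \<noteq> j" for i j
    using entry[of i j] closed that by simp
  have V_0: "V 0 0 = \<ominus> \<one>"
  proof -
    have "U 0 0 \<otimes> V 0 0 = \<one>"
      using LTDFM_mult_diagonal[OF U V, of 0] inv by (simp add: LTDFM_ops)
    then have "\<ominus> V 0 0 = \<one>" using U_diag closed by (simp add: l_minus)
    then show ?thesis using closed minus_minus by metis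
  qed
  have V_Suc: "V (Suc m) 0 = V m 0" for m
  proof -
    have "\<zero> = (\<Oplus>k\<in>{0..Suc m}. U (Suc m) k \<otimes> V k 0)"
      using LTDFM_mult_entry[OF U V, of "Suc m" 0] inv by (simp add: LTDFM_ops)
    also have "\<dots> = U (Suc m) m \<otimes> V m 0 \<oplus> U (Suc m) (Suc m) \<otimes> V (Suc m) 0"
      using closed by (intro finsum_supported_on_pair) (auto simp: U_off lower_shift_def)
    also have "\<dots> = V m 0 \<ominus> V (Suc m) 0"
      using closed by (simp add: U_diag U_off lower_shift_def l_minus minus_eq)
    finally show ?thesis using closed r_right_minus_eq by metis
  qed
  have V_column: "V i 0 = \<ominus> \<one>" for i
    by (induction i) (simp_all add: V_0 V_Suc)
  have "column_finite R V" using V by (simp add: LTDFM_def CFM_simps)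
  then obtain N where "V N 0 = \<zero>" using column_finite_bound[of R V 0] by blast
  then have "\<ominus> \<one> = \<zero>" using V_column by simp
  then show False using nontrivial by (metis minus_minus minus_zero one_closed)
qed

lemma LTDFM_not_clean:
  assumes nontrivial: "\<one> \<noteq> \<zero>"
  shows "\<not> clean (LTDFM R)"
proof
  assume "clean (LTDFM R)"
  then obtain U E where U: "U \<in> Units (LTDFM R)" and E: "E \<in> carrier (LTDFM R)"
    and idem: "E \<otimes>\<^bsub>LTDFM R\<^esub> E = E" and split: "lower_shift R = U \<oplus>\<^bsub>LTDFM R\<^esub> E"
    using lower_shift_closed unfolding clean_def by blast
  have "E i i = \<one>" for i
  proof (rule idempotent_unit_eq_one)
    have unit: "U i i \<in> Units R" using LTDFM_Units_diagonal[OF U] .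
    have "U i i \<oplus> E i i = \<zero>"
      using fun_cong[OF fun_cong[OF split], of i i] by (simp add: LTDFM_ops lower_shift_def)
    then have "E i i = \<ominus> U i i"
      using unit LTDFM_entry_closed[OF E]
      by (metis Units_closed a_comm minus_equality)
    then show "E i i \<in> Units R"
      using unit Units_m_closed[OF Units_minus_one_closed unit]
      by (simp add: l_minus Units_closed)
    show "E i i \<otimes> E i i = E i i"
      using LTDFM_mult_diagonal[OF E E, of i] idem by simp
  qed
  then have "E = \<one>\<^bsub>LTDFM R\<^esub>" using LTDFM_unipotent_idempotent[OF E idem] by blast
  then show False using lower_shift_minus_one_not_unit[OF nontrivial] split U by blast
qed

end

theorem corollary5p5:
  fixes R :: "('a, 'm) ring_scheme"
  assumes "ring R"
    and "carrier R \<noteq> {\<zero>\<^bsub>R\<^esub>}"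
  shows "\<not> clean (LTDFM R)"
proof -
  interpret ring R by fact
  have "\<one>\<^bsub>R\<^esub> \<noteq> \<zero>\<^bsub>R\<^esub>" using assms(2) carrier_one_zero by blast
  then show ?thesis by (rule LTDFM_not_clean)
qed

end
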